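(* Let $(A,\wedge,\vee,\Rightarrow,\neg,\sim,0,1)$ be a symmetrical Heyting algebra. Let $Ob$ be the set of all prime filters of $A$, ordered by $R={\subseteq}$, let $\varphi:Ob\to Ob$ be $\varphi(P)=A\setminus\{\sim p: p\in P\}$, and let $\mathcal O_R$ with operations $\cap,\cup,\Rightarrow,\dot-,\neg,\sim,\emptyset,Ob$ be as described in the context. Then there exists an injective map $h:A\to\mathcal O_R$ such that for all $a,b\in A$: $h(0)=\emptyset$, $h(1)=Ob$, $h(a\wedge b)=h(a)\cap h(b)$, $h(a\vee b)=h(a)\cup h(b)$, $h(a\Rightarrow b)=h(a)\Rightarrow h(b)$, $h(\neg a)=\neg h(a)$ and $h(\sim a)=\sim h(a)$.
   Context: A symmetrical Heyting algebra is a Heyting algebra $(A,\wedge,\vee,\Rightarrow,\neg,0,1)$ (with $\neg a=a\Rightarrow 0$) with a unary operation $\sim$ satisfying $\sim\sim x=x$ and $\sim(x\wedge y)=\sim x\vee\sim y$. A prime filter is a proper filter $P$ such that $a\vee b\in P$ implies $a\in P$ or $b\in P$; $\varphi(P)$ is again a prime filter and $\varphi(\varphi(P))=P$. For $P\in Ob$ let $R(P)=\{Q\in Ob: P\subseteq Q\}$; for $X\subseteq Ob$ put $C_RX=\bigcup\{R(P):P\in X\}$, $I_RX=\bigcup\{R(P): P\in Ob,\ R(P)\subseteq X\}$, $\varphi(X)=\{\varphi(P):P\in X\}$, $\sim X=Ob\setminus\varphi(X)$, and $\mathcal O_R=\{X\subseteq Ob: I_RX=X\}$. On $\mathcal O_R$: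 $G\Rightarrow H=I_R((Ob\setminus G)\cup H)$, $G\,\dot-\,H=C_R(G\cap(Ob\setminus H))$, $\neg G=G\Rightarrow\emptyset$; $\mathcal O_R$ is closed under $\sim$. *)

theory Defs
  imports Main
begin

text \<open>Meet, join, 0 and 1 are \<^const>\<open>inf\<close>, \<^const>\<open>sup\<close>, \<^const>\<open>bot\<close> and \<^const>\<open>top\<close>
  of \<^class>\<open>bounded_lattice\<close>; distributivity follows from residuation. The one-element
  algebra is admitted.\<close>

class heyting_algebra = bounded_lattice +
  fixes himp :: "'a \<Rightarrow> 'a \<Rightarrow> 'a"  (infixr "\<rightarrow>\<^sub>H" 60)
    and hneg :: "'a \<Rightarrow> 'a"  ("\<not>\<^sub>H _" [81] 80)
  assumes himp_residuation: "inf c a \<le> b \<longleftrightarrow> c \<le> (a \<rightarrow>\<^sub>H b)"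
    and hneg_eq: "\<not>\<^sub>H a = (a \<rightarrow>\<^sub>H bot)"

class symmetrical_heyting_algebra = heyting_algebra +
  fixes dmneg :: "'a \<Rightarrow> 'a"  ("\<sim>\<^sub>H _" [81] 80)
  assumes dmneg_dmneg: "\<sim>\<^sub>H (\<sim>\<^sub>H x) = x"
    and dmneg_inf: "\<sim>\<^sub>H (inf x y) = sup (\<sim>\<^sub>H x) (\<sim>\<^sub>H y)"

definition lattice_filter :: "'a::bounded_lattice set \<Rightarrow> bool" where
  "lattice_filter F \<longleftrightarrow>
     F \<noteq> {} \<and> (\<forall>a\<in>F. \<forall>b\<in>F. inf a b \<in> F) \<and> (\<forall>a\<in>F. \<forall>b. a \<le> b \<longrightarrow> b \<in> F)"

definition prime_filter :: "'a::bounded_lattice set \<Rightarrow> bool" where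
  "prime_filter P \<longleftrightarrow>
     lattice_filter P \<and> P \<noteq> UNIV \<and> (\<forall>a b. sup a b \<in> P \<longrightarrow> a \<in> P \<or> b \<in> P)"

definition Ob :: "'a::bounded_lattice set set" where
  "Ob = {P. prime_filter P}"

definition R :: "'a::bounded_lattice set \<Rightarrow> 'a set set" where
  "R P = {Q \<in> Ob. P \<subseteq> Q}"

definition C_R :: "'a::bounded_lattice set set \<Rightarrow> 'a set set" where
  "C_R X = \<Union>{R P |P. P \<in> X}"

definition I_R :: "'a::bounded_lattice set set \<Rightarrow> 'a set set" where
  "I_R X = \<Union>{R P |P. P \<in> Ob \<and> R P \<subseteq> X}"

definition O_R :: "'a::bounded_lattice set set set" where
  "O_R = {X. X \<subseteq> Ob \<and> I_R X = X}"

definition phi :: "'a::symmetrical_heyting_algebra set \<Rightarrow> 'a set" where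
  "phi P = UNIV - {\<sim>\<^sub>H p |p. p \<in> P}"

definition O_imp :: "'a::bounded_lattice set set \<Rightarrow> 'a set set \<Rightarrow> 'a set set" where
  "O_imp G H = I_R ((Ob - G) \<union> H)"

definition O_diff :: "'a::bounded_lattice set set \<Rightarrow> 'a set set \<Rightarrow> 'a set set" where
  "O_diff G H = C_R (G \<inter> (Ob - H))"

definition O_neg :: "'a::bounded_lattice set set \<Rightarrow> 'a set set" where
  "O_neg G = O_imp G {}"

definition O_sim :: "'a::symmetrical_heyting_algebra set set \<Rightarrow> 'a set set" where
  "O_sim X = Ob - phi ` X"

text \<open>The maps above are total on sets; the next facts confirm that \<^const>\<open>phi\<close> restricts to
  an involution of \<^const>\<open>Ob\<close> and that \<^const>\<open>O_R\<close> is closed under the operations.\<close>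

lemma dmneg_sup: "\<sim>\<^sub>H (sup x y) = inf (\<sim>\<^sub>H x) (\<sim>\<^sub>H y)"
  for x y :: "'a::symmetrical_heyting_algebra"
  by (metis dmneg_dmneg dmneg_inf)

lemma dmneg_antimono: "x \<le> y \<Longrightarrow> \<sim>\<^sub>H y \<le> \<sim>\<^sub>H x"
  for x y :: "'a::symmetrical_heyting_algebra"
  by (metis dmneg_inf inf.absorb_iff1 sup.cobounded2)

lemma mem_phi_iff: "a \<in> phi P \<longleftrightarrow> \<sim>\<^sub>H a \<notin> P"
  for a :: "'a::symmetrical_heyting_algebra"
proof -
  have "(\<exists>p. a = \<sim>\<^sub>H p \<and> p \<in> P) \<longleftrightarrow> \<sim>\<^sub>H a \<in> P"
    by (metis dmneg_dmneg)
  then show ?thesis by (simp add: phi_def)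
qed

lemma phi_phi: "phi (phi P) = P"
  by (auto simp: mem_phi_iff dmneg_dmneg)

lemma phi_in_Ob:
  fixes P :: "'a::symmetrical_heyting_algebra set"
  assumes "P \<in> Ob"
  shows "phi P \<in> Ob"
proof -
  have ne: "P \<noteq> {}" and meet: "\<And>a b. a \<in> P \<Longrightarrow> b \<in> P \<Longrightarrow> inf a b \<in> P"
    and up: "\<And>a b. a \<in> P \<Longrightarrow> a \<le> b \<Longrightarrow> b \<in> P" and pr: "P \<noteq> UNIV"
    and prime: "\<And>a b. sup a b \<in> P \<Longrightarrow> a \<in> P \<or> b \<in> P"
    using assms by (auto simp: Ob_def prime_filter_def lattice_filter_def)
  have "phi P \<noteq> {}" "phi P \<noteq> UNIV"
    using ne pr mem_phi_iff dmneg_dmneg by (metis empty_iff UNIV_I equals0I UNIV_eq_I)+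
  moreover have "b \<in> phi P" if "a \<in> phi P" "a \<le> b" for a b
    using that up dmneg_antimono by (auto simp: mem_phi_iff)
  moreover have "inf a b \<in> phi P" if "a \<in> phi P" "b \<in> phi P" for a b
    using that prime by (auto simp: mem_phi_iff dmneg_inf)
  moreover have "a \<in> phi P \<or> b \<in> phi P" if "sup a b \<in> phi P" for a b
    using that meet by (auto simp: mem_phi_iff dmneg_sup)
  ultimately show ?thesis
    unfolding Ob_def prime_filter_def lattice_filter_def by blast
qed

lemma O_R_iff_upset: "X \<in> O_R \<longleftrightarrow> X \<subseteq> Ob \<and> (\<forall>P\<in>X. \<forall>Q\<in>Ob. P \<subseteq> Q \<longrightarrow> Q \<in> X)"
proof -
  have mem: "Q \<in> I_R X \<longleftrightarrow> (\<exists>P\<in>Ob. R P \<subseteq> X \<and> Q \<in> R P)" for Q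
    unfolding I_R_def by blast
  show ?thesis
    unfolding O_R_def set_eq_iff mem_Collect_eq mem R_def subset_iff by (safe; metis)
qed

lemma I_R_in_O_R: "I_R X \<in> O_R"
  unfolding O_R_iff_upset I_R_def R_def by blast

lemma C_R_in_O_R: "C_R X \<in> O_R"
  unfolding O_R_iff_upset C_R_def R_def by blast

lemma O_R_closed:
  "{} \<in> O_R" "Ob \<in> O_R"
  "G \<in> O_R \<Longrightarrow> H \<in> O_R \<Longrightarrow> G \<inter> H \<in> O_R"
  "G \<in> O_R \<Longrightarrow> H \<in> O_R \<Longrightarrow> G \<union> H \<in> O_R"
  "O_imp G H \<in> O_R" "O_diff G H \<in> O_R" "O_neg G \<in> O_R"
  unfolding O_imp_def O_diff_def O_neg_def
  by (auto simp only: I_R_in_O_R C_R_in_O_R) (auto simp: O_R_iff_upset)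

lemma O_sim_in_O_R:
  fixes X :: "'a::symmetrical_heyting_algebra set set"
  assumes "X \<in> O_R"
  shows "O_sim X \<in> O_R"
  unfolding O_R_iff_upset
proof (intro conjI ballI impI)
  show "O_sim X \<subseteq> Ob" by (auto simp: O_sim_def)
  fix P Q :: "'a set"
  assume PQ: "P \<in> O_sim X" "Q \<in> Ob" "P \<subseteq> Q"
  show "Q \<in> O_sim X"
  proof (rule ccontr)
    assume "Q \<notin> O_sim X"
    then obtain S where S: "S \<in> X" "Q = phi S" using PQ by (auto simp: O_sim_def)
    have "S \<subseteq> phi P" using PQ(3) S(2) by (auto simp: mem_phi_iff dmneg_dmneg)
    moreover have "phi P \<in> Ob" using PQ(1) by (auto simp: O_sim_def phi_in_Ob)
    ultimately have "phi P \<in> X" using assms S(1) by (auto simp: O_R_iff_upset)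
    then have "phi (phi P) \<in> phi ` X" by blast
    then show False using PQ(1) by (simp add: O_sim_def phi_phi)
  qed
qed

end

theory Submission
  imports Defs
begin

text \<open>The Stone map sends \<open>a\<close> to the set of prime filters containing \<open>a\<close>. By Zorn's lemma, a filter
  maximal among those that contain \<open>F\<close> and avoid \<open>b\<close> is prime. Separating \<open>b\<close> from the principal
  filter of \<open>a\<close> gives injectivity; separating \<open>b\<close> from the filter generated by \<open>P\<close> and \<open>a\<close> whenever
  \<open>a \<rightarrow>\<^sub>H b \<notin> P\<close> gives preservation of implication. The De Morgan negation is preserved because
  \<^const>\<open>phi\<close> is an involution of \<^const>\<open>Ob\<close> and \<open>a \<in> phi P\<close> holds iff \<open>\<sim>\<^sub>H a \<notin> P\<close>.\<close>

lemma lattice_filter_inf_iff: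
  assumes "lattice_filter F"
  shows "inf a b \<in> F \<longleftrightarrow> a \<in> F \<and> b \<in> F"
  using assms unfolding lattice_filter_def by (meson inf.cobounded1 inf.cobounded2)

lemma lattice_filter_up:
  "lattice_filter F \<Longrightarrow> a \<in> F \<Longrightarrow> a \<le> b \<Longrightarrow> b \<in> F"
  unfolding lattice_filter_def by blast

lemma lattice_filter_top: "lattice_filter F \<Longrightarrow> top \<in> F"
  unfolding lattice_filter_def by (meson ex_in_conv top_greatest)

lemma prime_filter_bot: "prime_filter P \<Longrightarrow> bot \<notin> P"
  unfolding prime_filter_def by (metis UNIV_eq_I bot_least lattice_filter_up)

lemma prime_filter_sup_iff:
  assumes "prime_filter P"
  shows "sup a b \<in> P \<longleftrightarrow> a \<in> P \<or> b \<in> P"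
  using assms unfolding prime_filter_def by (meson lattice_filter_up sup.cobounded1 sup.cobounded2)

lemma lattice_filter_atLeast: "lattice_filter {a..}"
  unfolding lattice_filter_def by (auto intro: order_trans)

text \<open>For a filter \<open>F\<close>, this is the filter generated by \<open>F\<close> and
  \<open>a\<close>.\<close>

definition filter_extend :: "'a::bounded_lattice set \<Rightarrow> 'a \<Rightarrow> 'a set" where
  "filter_extend F a = {z. \<exists>m\<in>F. inf m a \<le> z}"

lemma mem_filter_extend:
  assumes "lattice_filter F"
  shows "a \<in> filter_extend F a"
  using lattice_filter_top[OF assms] inf.cobounded2 unfolding filter_extend_def by blast

lemma lattice_filter_extend:
  assumes "lattice_filter F"
  shows "lattice_filter (filter_extend F a)"
  unfolding lattice_filter_def
proof (intro conjI ballI allI impI)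
  show "filter_extend F a \<noteq> {}"
    using mem_filter_extend[OF assms] by blast
next
  fix x y assume "x \<in> filter_extend F a" "y \<in> filter_extend F a"
  then obtain m n where mn: "m \<in> F" "inf m a \<le> x" "n \<in> F" "inf n a \<le> y"
    unfolding filter_extend_def by blast
  have "inf (inf m n) a \<le> inf x y"
    using mn(2,4) by (intro inf_greatest)
      (metis inf.coboundedI2 inf_assoc inf_left_commute)+
  then show "inf x y \<in> filter_extend F a"
    using mn(1,3) assms unfolding filter_extend_def by (auto simp: lattice_filter_inf_iff)
next
  fix x y assume "x \<in> filter_extend F a" "x \<le> y"
  then show "y \<in> filter_extend F a"
    unfolding filter_extend_def by (auto intro: order_trans)
qed

lemma subset_filter_extend: "F \<subseteq> filter_extend F a"
  unfolding filter_extend_def by (auto intro: inf.cobounded1)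

text \<open>Residuation turns \<open>inf m a \<le> b\<close> into
  \<open>m \<le> (a \<rightarrow>\<^sub>H b)\<close>, and \<open>F\<close> is upward closed. This
  link between generated filters and implication serves both primality and the preservation of
  implication.\<close>

lemma mem_filter_extend_iff_himp:
  fixes F :: "'a::heyting_algebra set"
  assumes "lattice_filter F"
  shows "b \<in> filter_extend F a \<longleftrightarrow> (a \<rightarrow>\<^sub>H b) \<in> F"
proof -
  have "b \<in> filter_extend F a \<longleftrightarrow> (\<exists>m\<in>F. m \<le> (a \<rightarrow>\<^sub>H b))"
    by (simp add: filter_extend_def himp_residuation)
  then show ?thesis
    using lattice_filter_up[OF assms] by blast
qed

lemma lattice_filter_Union_chain:
  assumes "\<C> \<noteq> {}" "\<And>F. F \<in> \<C> \<Longrightarrow> lattice_filter F"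
    and chain: "\<And>F G. F \<in> \<C> \<Longrightarrow> G \<in> \<C> \<Longrightarrow> F \<subseteq> G \<or> G \<subseteq> F"
  shows "lattice_filter (\<Union>\<C>)"
  unfolding lattice_filter_def
proof (intro conjI ballI allI impI)
  show "\<Union>\<C> \<noteq> {}"
    using assms(1,2) lattice_filter_top by blast
next
  fix a b assume "a \<in> \<Union>\<C>" "b \<in> \<Union>\<C>"
  then obtain F where "F \<in> \<C>" "a \<in> F" "b \<in> F"
    using chain by blast
  then show "inf a b \<in> \<Union>\<C>"
    using assms(2) lattice_filter_inf_iff by blast
next
  fix a b assume "a \<in> \<Union>\<C>" "a \<le> b"
  then show "b \<in> \<Union>\<C>"
    using assms(2) lattice_filter_up by blast
qed

lemma maximal_avoiding_filter_prime:
  fixes M :: "'a::heyting_algebra set"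
  assumes M: "lattice_filter M" "b \<notin> M"
    and max: "\<And>G. lattice_filter G \<Longrightarrow> b \<notin> G \<Longrightarrow> M \<subseteq> G \<Longrightarrow> G = M"
  shows "prime_filter M"
  unfolding prime_filter_def
proof (intro conjI allI impI)
  fix x y assume xy: "sup x y \<in> M"
  show "x \<in> M \<or> y \<in> M"
  proof (rule ccontr)
    assume nxy: "\<not> (x \<in> M \<or> y \<in> M)"
    \<comment> \<open>For \<open>z\<close> outside \<open>M\<close>, the filter generated by
      \<open>M\<close> and \<open>z\<close> is strictly larger than \<open>M\<close>, so by
      maximality it must contain \<open>b\<close>.\<close>
    have "(z \<rightarrow>\<^sub>H b) \<in> M" if "z \<notin> M" for z
      using that max[OF lattice_filter_extend[OF M(1)] _ subset_filter_extend, of z]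
        mem_filter_extend[OF M(1), of z] mem_filter_extend_iff_himp[OF M(1), of b z] by auto
    then have "inf (x \<rightarrow>\<^sub>H b) (y \<rightarrow>\<^sub>H b) \<in> M" (is "?m \<in> M")
      using nxy M(1) by (simp add: lattice_filter_inf_iff)
    moreover have "inf (sup x y) ?m \<le> b"
    proof -
      have "inf x ?m \<le> b" "inf y ?m \<le> b"
        by (subst inf.commute, simp add: himp_residuation)+
      \<comment> \<open>Both \<open>x\<close> and \<open>y\<close> lie below
        \<open>?m \<rightarrow>\<^sub>H b\<close>, hence so does their join; distributivity enters
        only through residuation.\<close>
      then show ?thesis by (simp add: himp_residuation)
    qed
    ultimately show False
      using xy M by (meson lattice_filter_inf_iff lattice_filter_up)
  qed
qed (use M in auto)

lemma prime_filter_separation: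
  fixes F :: "'a::heyting_algebra set"
  assumes "lattice_filter F" "b \<notin> F"
  obtains P where "prime_filter P" "F \<subseteq> P" "b \<notin> P"
proof -
  define \<A> where "\<A> = {G. lattice_filter G \<and> F \<subseteq> G \<and> b \<notin> G}"
  have "\<exists>M\<in>\<A>. \<forall>X\<in>\<A>. M \<subseteq> X \<longrightarrow> X = M"
  proof (rule subset_Zorn_nonempty)
    show "\<A> \<noteq> {}" using assms unfolding \<A>_def by blast
  next
    fix \<C> assume "\<C> \<noteq> {}" "subset.chain \<A> \<C>"
    then have sub: "\<C> \<subseteq> \<A>" and chain: "\<And>G H. G \<in> \<C> \<Longrightarrow> H \<in> \<C> \<Longrightarrow> G \<subseteq> H \<or> H \<subseteq> G"
      by (auto simp: subset_chain_def)
    have "lattice_filter (\<Union>\<C>)"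
      using \<open>\<C> \<noteq> {}\<close> sub chain by (intro lattice_filter_Union_chain) (auto simp: \<A>_def)
    then show "\<Union>\<C> \<in> \<A>"
      using \<open>\<C> \<noteq> {}\<close> sub unfolding \<A>_def by blast
  qed
  then obtain M where "M \<in> \<A>" and max: "\<And>X. X \<in> \<A> \<Longrightarrow> M \<subseteq> X \<Longrightarrow> X = M"
    by blast
  then have M: "lattice_filter M" "F \<subseteq> M" "b \<notin> M"
    unfolding \<A>_def by simp_all
  have "prime_filter M"
  proof (rule maximal_avoiding_filter_prime[OF M(1,3)])
    fix G assume "lattice_filter G" "b \<notin> G" "M \<subseteq> G"
    \<comment> \<open>\<open>F \<subseteq> M \<subseteq> G\<close> puts \<open>G\<close> into the
      family, so maximality within the family gives maximality among all filters avoiding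
      \<open>b\<close>.\<close>
    then show "G = M" using M(2) max unfolding \<A>_def by blast
  qed
  with M show ?thesis using that by blast
qed

definition stone :: "'a::bounded_lattice \<Rightarrow> 'a set set" where
  "stone a = {P \<in> Ob. a \<in> P}"

text \<open>Separation makes \<open>stone\<close> an order embedding, from which injectivity follows
  by antisymmetry.\<close>

lemma stone_mono_iff:
  fixes a b :: "'a::heyting_algebra"
  shows "stone a \<subseteq> stone b \<longleftrightarrow> a \<le> b"
proof
  assume sub: "stone a \<subseteq> stone b"
  show "a \<le> b"
  proof (rule ccontr)
    assume "\<not> a \<le> b"
    then have "b \<notin> {a..}" by simp
    then obtain P where "prime_filter P" "{a..} \<subseteq> P" "b \<notin> P"
      using prime_filter_separation[OF lattice_filter_atLeast] by blast
    with sub show False by (auto simp: stone_def Ob_def)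
  qed
next
  assume "a \<le> b"
  then show "stone a \<subseteq> stone b"
    by (auto simp: stone_def Ob_def prime_filter_def intro: lattice_filter_up)
qed

lemma inj_stone: "inj (stone :: 'a::heyting_algebra \<Rightarrow> 'a set set)"
  by (rule injI) (metis stone_mono_iff order_antisym order_refl)

lemma stone_in_O_R: "stone a \<in> O_R"
  unfolding O_R_iff_upset stone_def by blast

lemma stone_bot: "stone bot = {}"
  by (auto simp: stone_def Ob_def prime_filter_bot)

lemma stone_top: "stone top = Ob"
  by (auto simp: stone_def Ob_def prime_filter_def lattice_filter_top)

lemma stone_inf: "stone (inf a b) = stone a \<inter> stone b"
  by (auto simp: stone_def Ob_def prime_filter_def lattice_filter_inf_iff)

lemma stone_sup: "stone (sup a b) = stone a \<union> stone b"
  by (auto simp: stone_def Ob_def prime_filter_sup_iff)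

text \<open>Inclusion is a preorder: if \<open>P \<in> R Q\<close> then
  \<open>R P \<subseteq> R Q\<close> by transitivity, and \<open>P \<in> R P\<close> for
  \<open>P \<in> Ob\<close> by reflexivity. So \<open>P\<close> itself can serve as the witness in
  the union.\<close>

lemma mem_I_R_iff: "P \<in> I_R X \<longleftrightarrow> P \<in> Ob \<and> R P \<subseteq> X"
  unfolding I_R_def R_def by blast

text \<open>Forward, this is modus ponens inside \<open>Q\<close>. Backward, if the implication is
  missing from \<open>P\<close>, then \<open>b\<close> is missing from the filter generated by
  \<open>P\<close> and \<open>a\<close>, and a prime filter separating the two refutes the
  right-hand side.\<close>

lemma himp_mem_prime_filter_iff:
  fixes P :: "'a::heyting_algebra set"
  assumes "lattice_filter P"
  shows "(a \<rightarrow>\<^sub>H b) \<in> P \<longleftrightarrow> (\<forall>Q. prime_filter Q \<and> P \<subseteq> Q \<and> a \<in> Q \<longrightarrow> b \<in> Q)"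
proof
  assume imp: "(a \<rightarrow>\<^sub>H b) \<in> P"
  have "inf (a \<rightarrow>\<^sub>H b) a \<le> b"
    by (simp add: himp_residuation)
  with imp show "\<forall>Q. prime_filter Q \<and> P \<subseteq> Q \<and> a \<in> Q \<longrightarrow> b \<in> Q"
    unfolding prime_filter_def by (meson lattice_filter_inf_iff lattice_filter_up subsetD)
next
  assume all: "\<forall>Q. prime_filter Q \<and> P \<subseteq> Q \<and> a \<in> Q \<longrightarrow> b \<in> Q"
  show "(a \<rightarrow>\<^sub>H b) \<in> P"
  proof (rule ccontr)
    assume "(a \<rightarrow>\<^sub>H b) \<notin> P"
    then obtain Q where "prime_filter Q" "filter_extend P a \<subseteq> Q" "b \<notin> Q"
      using prime_filter_separation[OF lattice_filter_extend[OF assms], of b a]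
        mem_filter_extend_iff_himp[OF assms, of b a] by blast
    with all show False
      using subset_filter_extend mem_filter_extend[OF assms] by blast
  qed
qed

lemma stone_himp:
  fixes a b :: "'a::heyting_algebra"
  shows "stone (a \<rightarrow>\<^sub>H b) = O_imp (stone a) (stone b)"
proof (rule set_eqI)
  fix P :: "'a set"
  have "lattice_filter P" if "P \<in> Ob"
    using that by (simp add: Ob_def prime_filter_def)
  then show "P \<in> stone (a \<rightarrow>\<^sub>H b) \<longleftrightarrow> P \<in> O_imp (stone a) (stone b)"
    using himp_mem_prime_filter_iff[of P a b]
    by (auto simp: stone_def O_imp_def mem_I_R_iff R_def Ob_def)
qed

lemma stone_hneg: "stone (\<not>\<^sub>H a) = O_neg (stone a)"
  for a :: "'a::heyting_algebra"
  by (simp add: hneg_eq stone_himp O_neg_def stone_bot)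

lemma stone_dmneg: "stone (\<sim>\<^sub>H a) = O_sim (stone a)"
  for a :: "'a::symmetrical_heyting_algebra"
proof -
  have "P \<in> phi ` stone a \<longleftrightarrow> \<sim>\<^sub>H a \<notin> P" if "P \<in> Ob" for P :: "'a set"
  proof -
    \<comment> \<open>As \<open>phi\<close> is its own inverse, image membership becomes preimage
      membership, where \<open>mem_phi_iff\<close> applies.\<close>
    have "P \<in> phi ` stone a \<longleftrightarrow> phi P \<in> stone a"
      by (metis image_iff phi_phi)
    then show ?thesis
      using that by (simp add: stone_def phi_in_Ob mem_phi_iff)
  qed
  then show ?thesis
    by (auto simp: O_sim_def stone_def)
qed

theorem theorem3p5:
  "\<exists>h :: 'a::symmetrical_heyting_algebra \<Rightarrow> 'a set set.
     inj h \<and> range h \<subseteq> O_R \<and>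
     h bot = {} \<and> h top = Ob \<and>
     (\<forall>a b.
        h (inf a b) = h a \<inter> h b \<and>
        h (sup a b) = h a \<union> h b \<and>
        h (a \<rightarrow>\<^sub>H b) = O_imp (h a) (h b) \<and>
        h (\<not>\<^sub>H a) = O_neg (h a) \<and>
        h (\<sim>\<^sub>H a) = O_sim (h a))"
proof (intro exI[of _ stone] conjI allI)
  show "range stone \<subseteq> (O_R :: 'a set set set)"
    by (auto simp: stone_in_O_R)
qed (rule inj_stone stone_bot stone_top stone_inf stone_sup stone_himp stone_hneg stone_dmneg)+

end
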